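(* For every $j$ with $1\le j\le S$, the approximation $u_{n+\frac jS}$ produced by $j$ substeps of the recycling scheme satisfies $$u_{n+\frac jS}=u_n+\tilde p_{j\delta t}\,g_n+R^S_{n+\frac jS},$$ with $$R^S_{n+\frac jS}=\sum_{k=1}^{j}\left(I+\tilde p_{\delta t}L\right)^{j-k}\tilde p_{\delta t}\left(F_{n+\frac{k-1}{S}}-F_n\right).$$
   Context: Let $L\in\mathbb{R}^{N\times N}$, $F:[0,\infty)\times\mathbb{R}^N\to\mathbb{R}^N$, $t_n\ge0$, $u_n\in\mathbb{R}^N$, $F_n=F(t_n,u_n)$ and $g_n=Lu_n+F_n$ (these come from the semilinear system $\frac{du}{dt}=Lu+F(t,u)$). For a square matrix $z$, $\varphi_1(z)=\sum_{k=0}^\infty \frac{z^k}{(k+1)!}$. Let $m\ge1$ and let $\mathcal{K}_m(L,g_n)=\mathrm{span}\{g_n,Lg_n,\dots,L^{m-1}g_n\}$, assumed of dimension $m$. The Arnoldi algorithm produces $V_m\in\mathbb{R}^{N\times m}$, whose columns are an orthonormal basis of $\mathcal{K}_m(L,g_n)$ (so $V_m^TV_m=I$), and $H_m=V_m^TLV_m\in\mathbb{R}^{m\times m}$. For $\tau\in\mathbb{R}$ put $\tilde p_\tau=\tau V_m\varphi_1(\tau H_m)V_m^T$. Recycling scheme: given $\Delta t>0$ and an integer $S\ge1$, put $\delta t=\Delta t/S$ and define $u_{n+\frac1S}=u_n+\tilde p_{\delta t}g_n$, and $u_{n+\frac jS}=u_{n+\frac{j-1}S}+\tilde p_{\delta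 t}\left(Lu_{n+\frac{j-1}S}+F_{n+\frac{j-1}S}\right)$ for $1<j\le S$, where $F_{n+\frac jS}=F(t_n+j\delta t,u_{n+\frac jS})$ (and $F_{n+\frac0S}=F_n$); the same $V_m,H_m$ are used for all substeps. *)

theory Defs
  imports "HOL-Analysis.Analysis"
begin

(* The power and times operations that the library provides on the type real ^ 'n ^ 'n are
   componentwise; matrix powers are therefore defined from the matrix product. *)

primrec matpow :: "real ^ 'n ^ 'n \<Rightarrow> nat \<Rightarrow> real ^ 'n ^ 'n" where
  "matpow A 0 = mat 1"
| "matpow A (Suc k) = A ** matpow A k"

definition phi1 :: "real ^ 'n ^ 'n \<Rightarrow> real ^ 'n ^ 'n" where
  "phi1 Z = (\<Sum>k. (1 / fact (k + 1)) *\<^sub>R matpow Z k)"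

definition semilinear_rhs ::
    "real ^ 'n ^ 'n \<Rightarrow> (real \<Rightarrow> real ^ 'n \<Rightarrow> real ^ 'n) \<Rightarrow> real \<Rightarrow> real ^ 'n \<Rightarrow> real ^ 'n" where
  "semilinear_rhs L F t u = L *v u + F t u"

definition krylov :: "real ^ 'n ^ 'n \<Rightarrow> real ^ 'n \<Rightarrow> nat \<Rightarrow> (real ^ 'n) set" where
  "krylov L g m = span ((\<lambda>k. matpow L k *v g) ` {..<m})"

(* The number m of Krylov vectors is CARD('m); V is an N x m matrix.  The predicate records what
   the Arnoldi algorithm guarantees: the columns of V are an orthonormal basis of the Krylov
   space, which is assumed to have full dimension m. *)

definition krylov_orthonormal_basis ::
    "real ^ 'n ^ 'n \<Rightarrow> real ^ 'n \<Rightarrow> real ^ 'm ^ 'n \<Rightarrow> bool" where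
  "krylov_orthonormal_basis L g V \<longleftrightarrow>
     dim (krylov L g CARD('m)) = CARD('m) \<and>
     (\<forall>i j. column i V \<bullet> column j V = (if i = j then 1 else 0)) \<and>
     span (columns V) = krylov L g CARD('m)"

definition hess :: "real ^ 'n ^ 'n \<Rightarrow> real ^ 'm ^ 'n \<Rightarrow> real ^ 'm ^ 'm" where
  "hess L V = transpose V ** L ** V"

definition ptilde :: "real ^ 'n ^ 'n \<Rightarrow> real ^ 'm ^ 'n \<Rightarrow> real \<Rightarrow> real ^ 'n ^ 'n" where
  "ptilde L V \<tau> = \<tau> *\<^sub>R (V ** phi1 (\<tau> *\<^sub>R hess L V) ** transpose V)"

(* recycled L F V t u d j is the approximation after j substeps of length d started from u at
   time t, with the same matrix V in every substep. *)

fun recycled ::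
    "real ^ 'n ^ 'n \<Rightarrow> (real \<Rightarrow> real ^ 'n \<Rightarrow> real ^ 'n) \<Rightarrow> real ^ 'm ^ 'n \<Rightarrow>
     real \<Rightarrow> real ^ 'n \<Rightarrow> real \<Rightarrow> nat \<Rightarrow> real ^ 'n" where
  "recycled L F V t u d 0 = u"
| "recycled L F V t u d (Suc 0) = u + ptilde L V d *v semilinear_rhs L F t u"
| "recycled L F V t u d (Suc (Suc j)) =
     recycled L F V t u d (Suc j) +
     ptilde L V d *v semilinear_rhs L F (t + real (Suc j) * d) (recycled L F V t u d (Suc j))"

definition recycled_F ::
    "real ^ 'n ^ 'n \<Rightarrow> (real \<Rightarrow> real ^ 'n \<Rightarrow> real ^ 'n) \<Rightarrow> real ^ 'm ^ 'n \<Rightarrow>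
     real \<Rightarrow> real ^ 'n \<Rightarrow> real \<Rightarrow> nat \<Rightarrow> real ^ 'n" where
  "recycled_F L F V t u d j = F (t + real j * d) (recycled L F V t u d j)"

definition recycling_remainder ::
    "real ^ 'n ^ 'n \<Rightarrow> (real \<Rightarrow> real ^ 'n \<Rightarrow> real ^ 'n) \<Rightarrow> real ^ 'm ^ 'n \<Rightarrow>
     real \<Rightarrow> real ^ 'n \<Rightarrow> real \<Rightarrow> nat \<Rightarrow> real ^ 'n" where
  "recycling_remainder L F V t u d j =
     (\<Sum>k = 1..j. (matpow (mat 1 + ptilde L V d ** L) (j - k) ** ptilde L V d) *v
        (recycled_F L F V t u d (k - 1) - F t u))"

end

theory Submission
  imports Defs
begin

text \<open>
  Write \<open>H\<close> for \<open>hess L V\<close>, \<open>p x\<close> for \<open>ptilde L V x\<close> and \<open>g\<close> for the right-hand side at the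
  start of the macro step.  The key is the addition formula (lemma \<open>ptilde_add\<close>)
    \<open>p (x + y) = p x + p y + p y ** L ** p x\<close>:
  a step of length \<open>x + y\<close> is a step of length \<open>x\<close> followed by one of length \<open>y\<close>, as it must be
  for a scheme that integrates a linear equation exactly on the Krylov space.  It comes from the
  matrix exponential.  The function \<open>\<Phi> x = x \<phi>\<^sub>1(x H)\<close> is the integral of \<open>exp (s H)\<close> over
  \<open>[0, x]\<close>, so that \<open>\<Phi> (x + y) = \<Phi> x + \<Phi> y exp (x H)\<close> and \<open>exp (x H) = I + H \<Phi> x\<close>.  Since
  \<open>H = V\<^sup>T L V\<close>, multiplying by \<open>V\<close> on the left and by \<open>V\<^sup>T\<close> on the right turns the product
  \<open>\<Phi> y H \<Phi> x\<close> into \<open>p y L p x\<close>.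

  The lemma then follows by induction on the number of substeps.  With \<open>d\<close> the substep length and
  \<open>u\<^sub>j\<close>, \<open>F\<^sub>j\<close>, \<open>R\<^sub>j\<close> the iterate, the nonlinearity and the remainder after \<open>j\<close> substeps,
    \<open>L u\<^sub>j + F\<^sub>j = g + L (u\<^sub>j - u\<^sub>0) + (F\<^sub>j - F\<^sub>0)\<close>,
  so inserting \<open>u\<^sub>j - u\<^sub>0 = p (j d) g + R\<^sub>j\<close> into the next substep produces
  \<open>p (j d) g + p d g + p d L p (j d) g\<close>, which is \<open>p ((j + 1) d) g\<close>, together with
  \<open>(I + p d L) R\<^sub>j + p d (F\<^sub>j - F\<^sub>0)\<close>, which is the remainder after \<open>j + 1\<close> substeps.
\<close>

section \<open>Power series in a matrix\<close>

lemma matrix_add_rdistrib: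
  fixes A B :: "real ^ 'n ^ 'm"
  shows "(A + B) ** C = A ** C + B ** C"
  by (vector matrix_matrix_mult_def sum.distrib[symmetric] field_simps)

lemma matpow_add: "matpow H (i + k) = matpow H i ** matpow H k"
  by (induction i) (simp_all add: matrix_mul_assoc)

lemma matpow_scaleR: "matpow (c *\<^sub>R H) k = c ^ k *\<^sub>R matpow H k"
  by (induction k) (simp_all add: scalar_matrix_assoc[symmetric] matrix_scalar_ac)

text \<open>
  The sum of the absolute values of all entries dominates every absolute row sum, so multiplying by
  \<open>H\<close> enlarges the largest entry of a column by at most that factor.
\<close>

lemma matpow_entry_bound:
  fixes H :: "real ^ 'n ^ 'n"
  shows "\<bar>matpow H k $ p $ q\<bar> \<le> (\<Sum>i\<in>UNIV. \<Sum>j\<in>UNIV. \<bar>H $ i $ j\<bar>) ^ k"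
proof (induction k arbitrary: p)
  case 0
  show ?case by (simp add: mat_def)
next
  case (Suc k)
  let ?C = "\<Sum>i\<in>UNIV. \<Sum>j\<in>UNIV. \<bar>H $ i $ j\<bar>"
  have "\<bar>matpow H (Suc k) $ p $ q\<bar> \<le> (\<Sum>r\<in>UNIV. \<bar>H $ p $ r\<bar> * \<bar>matpow H k $ r $ q\<bar>)"
    by (simp add: matrix_matrix_mult_def abs_mult[symmetric] sum_abs)
  also have "\<dots> \<le> (\<Sum>r\<in>UNIV. \<bar>H $ p $ r\<bar> * ?C ^ k)"
    by (intro sum_mono mult_left_mono Suc.IH) simp
  also have "\<dots> = (\<Sum>r\<in>UNIV. \<bar>H $ p $ r\<bar>) * ?C ^ k"
    by (simp add: sum_distrib_right)
  also have "\<dots> \<le> ?C * ?C ^ k"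
    by (intro mult_right_mono member_le_sum[where f = "\<lambda>i. \<Sum>j\<in>UNIV. \<bar>H $ i $ j\<bar>"])
       (auto intro!: sum_nonneg zero_le_power)
  finally show ?case by simp
qed

lemma matrix_sumsI:
  fixes f :: "nat \<Rightarrow> real ^ 'n ^ 'm"
  assumes "\<And>p q. (\<lambda>k. f k $ p $ q) sums (s $ p $ q)"
  shows "f sums s"
  using assms unfolding sums_def
  by (intro vec_tendstoI) (simp add: sum_component)

text \<open>
  Coefficients of an everywhere convergent power series.  The bound on the entries of the powers of
  \<open>H\<close> is geometric with a ratio that depends on \<open>H\<close>, which is why all radii are required.
\<close>

definition entire_coeffs :: "(nat \<Rightarrow> real) \<Rightarrow> bool" where
  "entire_coeffs a \<longleftrightarrow> (\<forall>r \<ge> 0. summable (\<lambda>k. \<bar>a k\<bar> * r ^ k))"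

lemma entire_exp: "entire_coeffs (\<lambda>k. x ^ k / fact k)"
proof -
  have "(\<lambda>k. \<bar>x ^ k / fact k\<bar> * r ^ k) = (\<lambda>k. inverse (fact k) * (\<bar>x\<bar> * r) ^ k)" for r
    by (simp add: fun_eq_iff power_abs power_mult_distrib divide_inverse abs_mult)
  then show ?thesis
    by (simp add: entire_coeffs_def summable_exp)
qed

lemma entire_phi: "entire_coeffs (\<lambda>k. x ^ Suc k / fact (Suc k))"
  unfolding entire_coeffs_def
proof (intro allI impI)
  fix r :: real assume "r \<ge> 0"
  have "summable (\<lambda>k. \<bar>x\<bar> * (\<bar>x ^ k / fact k\<bar> * r ^ k))"
    using entire_exp[of x] \<open>r \<ge> 0\<close> by (intro summable_mult) (simp add: entire_coeffs_def)
  then show "summable (\<lambda>k. \<bar>x ^ Suc k / fact (Suc k)\<bar> * r ^ k)"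
  proof (rule summable_comparison_test')
    fix k :: nat
    have "fact k \<le> (fact (Suc k) :: real)" by (rule fact_mono) simp
    then have "\<bar>x ^ Suc k / fact (Suc k)\<bar> \<le> \<bar>x\<bar> * \<bar>x ^ k / fact k\<bar>"
      by (simp add: abs_mult power_abs frac_le del: fact_Suc)
    then have "\<bar>x ^ Suc k / fact (Suc k)\<bar> * r ^ k \<le> \<bar>x\<bar> * \<bar>x ^ k / fact k\<bar> * r ^ k"
      using \<open>r \<ge> 0\<close> by (intro mult_right_mono) simp_all
    then show "norm (\<bar>x ^ Suc k / fact (Suc k)\<bar> * r ^ k) \<le> \<bar>x\<bar> * (\<bar>x ^ k / fact k\<bar> * r ^ k)"
      using \<open>r \<ge> 0\<close> by (simp only: real_norm_def abs_mult abs_abs power_abs abs_of_nonneg mult.assoc)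
  qed
qed

lemma summable_entry:
  assumes "entire_coeffs a"
  shows "summable (\<lambda>k. norm (a k * matpow H k $ p $ q))"
proof (rule summable_comparison_test')
  let ?C = "\<Sum>i\<in>UNIV. \<Sum>j\<in>UNIV. \<bar>H $ i $ j\<bar>"
  show "summable (\<lambda>k. \<bar>a k\<bar> * ?C ^ k)"
    using assms by (simp add: entire_coeffs_def sum_nonneg)
  show "norm (norm (a k * matpow H k $ p $ q)) \<le> \<bar>a k\<bar> * ?C ^ k" for k
    using matpow_entry_bound[of H k p q] by (simp add: abs_mult mult_left_mono)
qed

definition matrix_series :: "(nat \<Rightarrow> real) \<Rightarrow> real ^ 'n ^ 'n \<Rightarrow> real ^ 'n ^ 'n" where
  "matrix_series a H = (\<Sum>k. a k *\<^sub>R matpow H k)"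

lemma matrix_series_sums:
  assumes "entire_coeffs a"
  shows "(\<lambda>k. a k *\<^sub>R matpow H k) sums matrix_series a H"
proof -
  have "(\<lambda>k. a k *\<^sub>R matpow H k) sums (\<chi> p q. \<Sum>k. a k * matpow H k $ p $ q)"
    by (intro matrix_sumsI)
       (simp add: summable_sums summable_norm_cancel[OF summable_entry[OF assms]])
  then show ?thesis
    by (simp add: matrix_series_def sums_iff)
qed

lemma matrix_series_entry:
  assumes "entire_coeffs a"
  shows "matrix_series a H $ p $ q = (\<Sum>k. a k * matpow H k $ p $ q)"
proof -
  have "(\<lambda>k. (a k *\<^sub>R matpow H k) $ p $ q) sums (matrix_series a H $ p $ q)"
    by (intro bounded_linear.sums[OF bounded_linear_vec_nth] matrix_series_sums assms)
  then show ?thesis by (simp add: sums_iff)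
qed

text \<open>
  An entry of the product of two series is a finite sum of products of absolutely convergent real
  series.  The real Cauchy product theorem therefore applies entry by entry, and the sum over the
  inner matrix index reassembles \<open>matpow H i ** matpow H (n - i)\<close> to \<open>matpow H n\<close>.
\<close>

lemma matrix_series_Cauchy_product:
  assumes "entire_coeffs a" "entire_coeffs b"
  shows "(\<lambda>n. (\<Sum>i\<le>n. a i * b (n - i)) *\<^sub>R matpow H n) sums
           (matrix_series a H ** matrix_series b H)"
proof (rule matrix_sumsI)
  fix p q
  let ?A = "\<lambda>r i. a i * matpow H i $ p $ r" and ?B = "\<lambda>r k. b k * matpow H k $ r $ q"
  have "(\<lambda>n. \<Sum>r\<in>UNIV. \<Sum>i\<le>n. ?A r i * ?B r (n - i)) sums
          (\<Sum>r\<in>UNIV. (\<Sum>k. ?A r k) * (\<Sum>k. ?B r k))"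
    by (intro sums_sum Cauchy_product_sums summable_entry assms)
  also have "(\<Sum>r\<in>UNIV. (\<Sum>k. ?A r k) * (\<Sum>k. ?B r k)) =
               (matrix_series a H ** matrix_series b H) $ p $ q"
    by (simp add: matrix_matrix_mult_def matrix_series_entry assms)
  also have "(\<lambda>n. \<Sum>r\<in>UNIV. \<Sum>i\<le>n. ?A r i * ?B r (n - i)) =
               (\<lambda>n. ((\<Sum>i\<le>n. a i * b (n - i)) *\<^sub>R matpow H n) $ p $ q)"
  proof
    fix n
    have "(\<Sum>r\<in>UNIV. \<Sum>i\<le>n. ?A r i * ?B r (n - i)) =
            (\<Sum>i\<le>n. a i * b (n - i) * (matpow H i ** matpow H (n - i)) $ p $ q)"
      by (subst sum.swap) (simp add: matrix_matrix_mult_def sum_distrib_left mult.assoc mult.left_commute)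
    also have "\<dots> = (\<Sum>i\<le>n. a i * b (n - i) * matpow H n $ p $ q)"
      by (intro sum.cong refl) (simp add: matpow_add[symmetric])
    finally show "(\<Sum>r\<in>UNIV. \<Sum>i\<le>n. ?A r i * ?B r (n - i)) =
        ((\<Sum>i\<le>n. a i * b (n - i)) *\<^sub>R matpow H n) $ p $ q"
      by (simp add: sum_distrib_right)
  qed
  finally show "(\<lambda>n. ((\<Sum>i\<le>n. a i * b (n - i)) *\<^sub>R matpow H n) $ p $ q) sums
                  ((matrix_series a H ** matrix_series b H) $ p $ q)" .
qed

section \<open>The addition formula\<close>

abbreviation mexp :: "real ^ 'n ^ 'n \<Rightarrow> real \<Rightarrow> real ^ 'n ^ 'n" where
  "mexp H x \<equiv> matrix_series (\<lambda>k. x ^ k / fact k) H"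

text \<open>
  The integral of \<open>mexp H s\<close> for \<open>s\<close> over \<open>[0, x]\<close>, term by term; \<open>H\<close> may be singular, so the quotient of
  \<open>exp (x H) - I\<close> by \<open>H\<close> cannot serve as a definition.
\<close>

abbreviation Phi :: "real ^ 'n ^ 'n \<Rightarrow> real \<Rightarrow> real ^ 'n ^ 'n" where
  "Phi H x \<equiv> matrix_series (\<lambda>k. x ^ Suc k / fact (Suc k)) H"

lemma scaleR_phi1: "x *\<^sub>R phi1 (x *\<^sub>R H) = Phi H x"
proof (cases "x = 0")
  case False
  let ?f = "\<lambda>k. (x ^ Suc k / fact (Suc k)) *\<^sub>R matpow H k"
  have "(\<lambda>k. inverse x *\<^sub>R ?f k) sums (inverse x *\<^sub>R Phi H x)"
    by (intro sums_scaleR_right matrix_series_sums entire_phi)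
  also have "(\<lambda>k. inverse x *\<^sub>R ?f k) = (\<lambda>k. (1 / fact (k + 1)) *\<^sub>R matpow (x *\<^sub>R H) k)"
    using False by (simp add: fun_eq_iff matpow_scaleR)
  finally have "phi1 (x *\<^sub>R H) = inverse x *\<^sub>R Phi H x"
    by (simp add: phi1_def sums_iff)
  then show ?thesis using False by simp
qed (simp add: matrix_series_def)

lemma mexp_eq_Phi: "mexp H x = mat 1 + H ** Phi H x"
proof -
  have "bounded_linear (\<lambda>X. H ** X)"
    by (intro linear_linear[THEN iffD2] linearI)
       (simp_all add: matrix_add_ldistrib matrix_scalar_ac scalar_matrix_assoc[symmetric])
  then have "(\<lambda>k. H ** ((x ^ Suc k / fact (Suc k)) *\<^sub>R matpow H k)) sums (H ** Phi H x)"
    by (rule bounded_linear.sums) (intro matrix_series_sums entire_phi)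
  then have "(\<lambda>k. (x ^ Suc k / fact (Suc k)) *\<^sub>R matpow H (Suc k)) sums (H ** Phi H x)"
    by (simp add: matrix_scalar_ac scalar_matrix_assoc[symmetric] del: power_Suc fact_Suc)
  from sums_Suc[OF this] show ?thesis
    by (simp add: matrix_series_def sums_iff add.commute)
qed

text \<open>
  Splitting the integral of \<open>exp (s H)\<close> over \<open>[0, x + y]\<close> at \<open>x\<close>.  On coefficients this is the
  binomial theorem for \<open>(x + y) ^ (n + 1)\<close>: the Cauchy product of the two series on the right supplies
  all of its terms but the one without \<open>y\<close>, and that one is the coefficient of \<open>Phi H x\<close>.
\<close>

lemma Phi_add: "Phi H (x + y) = Phi H x + Phi H y ** mexp H x"
proof -
  have coeff: "(\<Sum>i\<le>n. y ^ Suc i / fact (Suc i) * (x ^ (n - i) / fact (n - i))) =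
      (x + y) ^ Suc n / fact (Suc n) - x ^ Suc n / fact (Suc n)" for n
  proof -
    have "(x + y) ^ Suc n / fact (Suc n) =
            (\<Sum>i\<le>Suc n. y ^ i / fact i * (x ^ (Suc n - i) / fact (Suc n - i)))"
      unfolding add.commute[of x y] binomial_ring sum_divide_distrib
      by (intro sum.cong refl) (simp add: binomial_fact del: power_Suc fact_Suc)
    then show ?thesis
      by (subst (asm) sum.atMost_Suc_shift) simp
  qed
  have "(\<lambda>n. ((x + y) ^ Suc n / fact (Suc n)) *\<^sub>R matpow H n -
             (x ^ Suc n / fact (Suc n)) *\<^sub>R matpow H n) sums (Phi H y ** mexp H x)"
    using matrix_series_Cauchy_product[OF entire_phi[of y] entire_exp[of x], of H]
    unfolding coeff by (simp add: scaleR_diff_left del: power_Suc fact_Suc)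
  moreover have "(\<lambda>n. ((x + y) ^ Suc n / fact (Suc n)) *\<^sub>R matpow H n -
             (x ^ Suc n / fact (Suc n)) *\<^sub>R matpow H n) sums (Phi H (x + y) - Phi H x)"
    by (intro sums_diff matrix_series_sums entire_phi)
  ultimately have "Phi H y ** mexp H x = Phi H (x + y) - Phi H x"
    by (rule sums_unique2)
  then show ?thesis by simp
qed

text \<open>
  \<open>Phi H y ** mexp H x\<close> is \<open>Phi H y + Phi H y ** H ** Phi H x\<close>, and the factor \<open>H\<close> in the middle
  supplies the \<open>transpose V\<close> and \<open>V\<close> that complete the two neighbouring copies of \<open>Phi\<close> to
  \<open>ptilde\<close>.
\<close>

lemma ptilde_add:
  "ptilde L V (x + y) = ptilde L V x + ptilde L V y + ptilde L V y ** L ** ptilde L V x"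
proof -
  let ?H = "hess L V"
  have p: "ptilde L V z = V ** Phi ?H z ** transpose V" for z
    unfolding ptilde_def scaleR_phi1[symmetric]
    by (simp add: scalar_matrix_assoc[symmetric] matrix_scalar_ac)
  show ?thesis
    unfolding p Phi_add[of x y] mexp_eq_Phi
    by (simp add: hess_def matrix_add_ldistrib matrix_add_rdistrib matrix_mul_assoc)
qed

lemma ptilde_zero: "ptilde L V 0 = 0"
  by (simp add: ptilde_def)

section \<open>The recycling scheme\<close>

text \<open>Removes the special case of the first substep, which is the general one at \<open>j = 0\<close>.\<close>

lemma recycled_Suc:
  "recycled L F V t u d (Suc j) = recycled L F V t u d j +
     ptilde L V d *v (L *v recycled L F V t u d j + recycled_F L F V t u d j)"
  by (cases j) (simp_all add: semilinear_rhs_def recycled_F_def)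

lemma recycling_remainder_Suc:
  "recycling_remainder L F V t u d (Suc j) =
     (mat 1 + ptilde L V d ** L) *v recycling_remainder L F V t u d j +
     ptilde L V d *v (recycled_F L F V t u d j - F t u)"
proof -
  have "(mat 1 + ptilde L V d ** L) *v recycling_remainder L F V t u d j =
    (\<Sum>k = 1..j. (matpow (mat 1 + ptilde L V d ** L) (Suc j - k) ** ptilde L V d) *v
        (recycled_F L F V t u d (k - 1) - F t u))"
    unfolding recycling_remainder_def linear_sum[OF matrix_vector_mul_linear]
    by (intro sum.cong refl) (simp add: Suc_diff_le matrix_vector_mul_assoc matrix_mul_assoc)
  then show ?thesis
    by (simp add: recycling_remainder_def)
qed

lemma recycled_eq:
  "recycled L F V t u d j =
     u + ptilde L V (real j * d) *v semilinear_rhs L F t u + recycling_remainder L F V t u d j"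
proof (induction j)
  case 0
  show ?case by (simp add: ptilde_zero recycling_remainder_def)
next
  case (Suc j)
  let ?g = "semilinear_rhs L F t u" and ?p = "ptilde L V d" and ?P = "ptilde L V (real j * d)"
  let ?R = "recycling_remainder L F V t u d j" and ?f = "recycled_F L F V t u d j"
  have P: "ptilde L V (real (Suc j) * d) = ?P + ?p + ?p ** L ** ?P"
    using ptilde_add[of L V "real j * d" d] by (simp add: algebra_simps)
  \<comment> \<open>The linear part is expanded about \<open>u\<close>, so that \<open>L *v u\<close> combines with \<open>F t u\<close>
     into \<open>semilinear_rhs L F t u\<close>.\<close>
  have g: "L *v (u + ?P *v ?g + ?R) + ?f = ?g + L *v (?P *v ?g) + L *v ?R + (?f - F t u)"
    by (simp add: semilinear_rhs_def matrix_vector_right_distrib)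
  then show ?case
    unfolding recycled_Suc recycling_remainder_Suc P Suc.IH g
    by (simp add: matrix_vector_right_distrib matrix_vector_mult_diff_distrib
        matrix_vector_mult_add_rdistrib
        matrix_vector_mul_assoc[symmetric])
qed

theorem lemma3p3:
  fixes L :: "real ^ 'n ^ 'n"
    and F :: "real \<Rightarrow> real ^ 'n \<Rightarrow> real ^ 'n"
    and V :: "real ^ 'm ^ 'n"
    and t\<^sub>n \<Delta>t \<delta>t :: real
    and u\<^sub>n g\<^sub>n :: "real ^ 'n"
    and S j :: nat
  assumes "t\<^sub>n \<ge> 0"
    and "g\<^sub>n = semilinear_rhs L F t\<^sub>n u\<^sub>n"
    and "krylov_orthonormal_basis L g\<^sub>n V"
    and "\<Delta>t > 0"
    and "S \<ge> 1"
    and "\<delta>t = \<Delta>t / real S"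
    and "1 \<le> j" and "j \<le> S"
  shows "recycled L F V t\<^sub>n u\<^sub>n \<delta>t j =
           u\<^sub>n + ptilde L V (real j * \<delta>t) *v g\<^sub>n + recycling_remainder L F V t\<^sub>n u\<^sub>n \<delta>t j"
  unfolding \<open>g\<^sub>n = semilinear_rhs L F t\<^sub>n u\<^sub>n\<close> by (rule recycled_eq)

end
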